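(* Let $\mathcal{E}\subseteq\mathbb{C}^{n\times n}$ be a closed set satisfying $\mathcal{E}\cap\mathbb{R}^{n\times n}\neq\varnothing$, and for $A\in\mathbb{R}^{n\times n}$ define $$d_{\mathbb{C}}(A)=\min_{X\in\mathcal{E}}\|A-X\|_F,\qquad d_{\mathbb{R}}(A)=\min_{X\in\mathcal{E}\cap\mathbb{R}^{n\times n}}\|A-X\|_F.$$ Then the set $$\mathcal{G}=\{A\in\mathbb{R}^{n\times n}:d_{\mathbb{C}}(A)<d_{\mathbb{R}}(A)\}$$ is open in $\mathbb{R}^{n\times n}$. In particular, if $d_{\mathbb{C}}(A)<d_{\mathbb{R}}(A)$, then $A+E\in\mathcal{G}$ for every $E\in\mathbb{R}^{n\times n}$ such that $$\|E\|_F<\frac{d_{\mathbb{R}}(A)-d_{\mathbb{C}}(A)}{2}.$$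
   Context: $\|\cdot\|_F$ is the Frobenius norm. *)

theory Defs
  imports "HOL-Analysis.Analysis"
begin

text \<open>
  The library norm on \<open>'a ^ 'n ^ 'm\<close> is the \<open>\<ell>\<^sup>2\<close> norm of the \<open>\<ell>\<^sup>2\<close> norms of the rows,
  that is, the Frobenius norm (for real and for complex matrices); so \<open>norm\<close> is used below.
\<close>

lemma norm_matrix_eq_Frobenius:
  fixes A :: "'a::real_normed_vector ^ 'n ^ 'm"
  shows "norm A = sqrt (\<Sum>i\<in>UNIV. \<Sum>j\<in>UNIV. (norm (A $ i $ j))\<^sup>2)"
  by (simp add: norm_vec_def L2_set_def sum_nonneg)

abbreviation complex_matrix :: "real ^ 'n ^ 'n \<Rightarrow> complex ^ 'n ^ 'n" where
  "complex_matrix \<equiv> map_matrix complex_of_real"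

text \<open>\<open>\<real>\<^bsup>n\<times>n\<^esup>\<close> as a subset of \<open>\<complex>\<^bsup>n\<times>n\<^esup>\<close>.\<close>

definition real_matrices :: "(complex ^ 'n ^ 'n) set" where
  "real_matrices = range complex_matrix"

text \<open>
  The distances are minima, not merely infima: \<open>LEAST\<close> on the reals is the least element
  of the set of values, which exists when the set of candidates is closed and nonempty
  (lemma \<open>least_distance_attained\<close>).
\<close>

definition dist_complex :: "(complex ^ 'n ^ 'n) set \<Rightarrow> real ^ 'n ^ 'n \<Rightarrow> real" where
  "dist_complex \<E> A = (LEAST d. \<exists>X\<in>\<E>. d = norm (complex_matrix A - X))"

definition dist_real :: "(complex ^ 'n ^ 'n) set \<Rightarrow> real ^ 'n ^ 'n \<Rightarrow> real" where
  "dist_real \<E> A = (LEAST d. \<exists>X\<in>\<E> \<inter> real_matrices. d = norm (complex_matrix A - X))"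

definition complex_closer :: "(complex ^ 'n ^ 'n) set \<Rightarrow> (real ^ 'n ^ 'n) set" where
  "complex_closer \<E> = {A. dist_complex \<E> A < dist_real \<E> A}"

lemma least_distance_attained:
  fixes S :: "(complex ^ 'n ^ 'n) set"
  assumes "closed S" "S \<noteq> {}"
  obtains X where "X \<in> S" "(LEAST d. \<exists>X\<in>S. d = norm (B - X)) = norm (B - X)"
    "\<And>Y. Y \<in> S \<Longrightarrow> norm (B - X) \<le> norm (B - Y)"
proof -
  obtain X where X: "X \<in> S" "\<And>Y. Y \<in> S \<Longrightarrow> norm (B - X) \<le> norm (B - Y)"
    using distance_attains_inf[OF assms, of B] by (auto simp: dist_norm)
  moreover have "(LEAST d. \<exists>X\<in>S. d = norm (B - X)) = norm (B - X)"
    using X by (intro Least_equality) auto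
  ultimately show thesis using that by blast
qed

lemma closed_real_matrices: "closed (real_matrices :: (complex ^ 'n ^ 'n) set)"
proof -
  have "real_matrices = {X :: complex ^ 'n ^ 'n. \<forall>i j. X $ i $ j \<in> \<real>}" (is "_ = ?S")
  proof (intro equalityI subsetI)
    fix X :: "complex ^ 'n ^ 'n" assume "X \<in> ?S"
    then have "X = complex_matrix (\<chi> i j. Re (X $ i $ j))"
      by (auto simp: vec_eq_iff)
    then show "X \<in> real_matrices" unfolding real_matrices_def by blast
  qed (auto simp: real_matrices_def)
  also have "\<dots> = (\<Inter>i. \<Inter>j. (\<lambda>X. X $ i $ j) -` \<real>)" by auto
  also have "closed \<dots>"
    by (intro closed_INT ballI closed_vimage closed_complex_Reals continuous_intros)
  finally show ?thesis .
qed

end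

theory Submission
  imports Defs
begin

text \<open>
  Distance to a fixed set is 1-Lipschitz, so a perturbation \<open>E\<close> shrinks the gap
  \<open>d\<^sub>\<real> - d\<^sub>\<complex>\<close> by at most twice the norm of \<open>E\<close>.
\<close>

text \<open>Both sides are attained on a nonempty closed set, and two minimizers are equally far
  from \<open>B\<close>. Passing to \<open>infdist\<close> makes its triangle inequality
  available.\<close>

lemma least_distance_eq_infdist:
  fixes S :: "(complex ^ 'n ^ 'n) set"
  assumes "closed S" "S \<noteq> {}"
  shows "(LEAST d. \<exists>X\<in>S. d = norm (B - X)) = infdist B S"
proof -
  obtain X where X: "X \<in> S" "(LEAST d. \<exists>X\<in>S. d = norm (B - X)) = norm (B - X)"
    "\<And>Y. Y \<in> S \<Longrightarrow> norm (B - X) \<le> norm (B - Y)"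
    using least_distance_attained[OF assms] by blast
  obtain Y where Y: "Y \<in> S" "infdist B S = dist B Y"
    using infdist_attains_inf[OF assms] by blast
  show ?thesis
    using X Y infdist_le[OF X(1), of B] X(3)[OF Y(1)] by (simp add: dist_norm)
qed

lemma norm_complex_matrix: "norm (complex_matrix A) = norm A"
  by (simp add: norm_matrix_eq_Frobenius)

text \<open>The embedding is additive and preserves the modulus of each entry, so perturbations can
  be measured among real matrices.\<close>

lemma dist_complex_matrix: "dist (complex_matrix A) (complex_matrix B) = dist A B"
proof -
  have "complex_matrix A - complex_matrix B = complex_matrix (A - B)"
    by (simp add: vec_eq_iff)
  then show ?thesis
    by (simp add: dist_norm norm_complex_matrix)
qed

theorem theorem2p5:
  fixes \<E> :: "(complex ^ 'n ^ 'n) set"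
  assumes "closed \<E>" and "\<E> \<inter> real_matrices \<noteq> {}"
  shows "open (complex_closer \<E>) \<and>
    (\<forall>A. dist_complex \<E> A < dist_real \<E> A \<longrightarrow>
      (\<forall>E :: real ^ 'n ^ 'n. norm E < (dist_real \<E> A - dist_complex \<E> A) / 2 \<longrightarrow>
        A + E \<in> complex_closer \<E>))"
proof -
  have dC: "dist_complex \<E> A = infdist (complex_matrix A) \<E>" for A
    unfolding dist_complex_def using assms by (intro least_distance_eq_infdist) auto
  have dR: "dist_real \<E> A = infdist (complex_matrix A) (\<E> \<inter> real_matrices)" for A
    unfolding dist_real_def
    using assms closed_real_matrices by (intro least_distance_eq_infdist) auto
  \<comment> \<open>This ball of radius half the gap serves both the openness and the explicit bound
    on \<open>E\<close>.\<close>
  have near: "B \<in> complex_closer \<E>"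
    if "dist A B < (dist_real \<E> A - dist_complex \<E> A) / 2" for A B
  proof -
    have "dist_complex \<E> B \<le> dist_complex \<E> A + dist A B"
      using infdist_triangle[of "complex_matrix B" \<E> "complex_matrix A"]
      by (simp add: dC dist_complex_matrix dist_commute)
    \<comment> \<open>The roles of \<open>A\<close> and \<open>B\<close> are swapped here: the
      complex distance at \<open>B\<close> needs an upper bound, the real one a lower bound.\<close>
    moreover have "dist_real \<E> A \<le> dist_real \<E> B + dist A B"
      using infdist_triangle[of "complex_matrix A" "\<E> \<inter> real_matrices" "complex_matrix B"]
      by (simp add: dR dist_complex_matrix)
    \<comment> \<open>With \<open>r = dist A B\<close>, \<open>2 * r\<close> is below the gap, so
      d_C(B) \<le> d_C(A) + r < d_R(A) - r \<le> d_R(B).\<close>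
    ultimately show ?thesis
      using that by (simp add: complex_closer_def)
  qed
  have "open (complex_closer \<E>)"
    unfolding open_dist
  proof
    fix A assume "A \<in> complex_closer \<E>"
    \<comment> \<open>Half the gap is the witness for the radius \<open>e\<close>.\<close>
    then have "0 < (dist_real \<E> A - dist_complex \<E> A) / 2"
      by (simp add: complex_closer_def)
    then show "\<exists>e>0. \<forall>B. dist B A < e \<longrightarrow> B \<in> complex_closer \<E>"
      using near by (metis dist_commute)
  qed
  moreover have "A + E \<in> complex_closer \<E>"
    if "norm E < (dist_real \<E> A - dist_complex \<E> A) / 2" for A E
    using near[of A "A + E"] that by (simp add: dist_norm)
  ultimately show ?thesis by blast
qed

end
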